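(* Let $m=2$, with reset sites $\{z,z'\}$, $z'=\sigma(z)\ne z$. Assume conditions (S1)--(S4) of the context and Assumption (M): the function $R(\gamma):=u(z;\gamma)/u(z';\gamma)$ is strictly monotone in $\gamma$ on $(0,1)$, with $R'(\gamma)$ of constant non-zero sign. Identify $\alpha\in(0,1)$ with the distribution $\pi_z=\alpha$, $\pi_{z'}=1-\alpha$, and write $$C(\alpha,\gamma)=\frac{\alpha\,u(z;\gamma)+(1-\alpha)\,u(z';\gamma)}{\alpha\,s(z;\gamma)+(1-\alpha)\,s(z';\gamma)} .$$ Put $$\alpha^*=\frac{\sqrt{\kappa(z')}}{\sqrt{\kappa(z)}+\sqrt{\kappa(z')}},\qquad C^*=\frac{1}{1+\sqrt K},\qquad K=\kappa(z)\kappa(z').$$ Then $\alpha^*\in(0,1)$ is the unique global separatrix of the coupling functional on $(0,1)$; specifically: (i) $C(\alpha^*,\gamma)=C^*$ for all $\gamma\in(0,1)$; (ii) for every $\alpha\in(0,1)$ with $\alpha\neq\alpha^*$, the function $\gamma\mapsto C(\alpha,\gamma)$ is strictly monotone on $(0,1)$ and its derivative has constant sign, with $$\operatorname{sgn}\bigl(\partial_\gamma C(\alpha,\gamma)\bigr)=\operatorname{sgn}(\alpha-\alpha^* )\cdot\operatorname{sgn}(R'(\gamma))\qquad\text{for all }\gamma\in(0,1).$$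
   Context: Here $m=2$; $z,z'$ are two distinct points (the reset sites), and $\Delta_1$ is the simplex of probability distributions on $\{z,z'\}$, with relative interior $\Delta_1^\circ$ (both weights positive), identified with $(0,1)$ through $\alpha=\pi_z$. The coupling functional is a smooth functional $C:\Delta_{1}\times(0,1)\to\mathbb{R}$. Conditions: (S1) For each fixed $\gamma\in(0,1)$ the map $\pi\mapsto C(\pi,\gamma)$ is of class $\mathcal{C}^1$ on $\Delta_{1}^\circ$ and extends continuously to the boundary. (S2) There are functions $u(\cdot;\gamma), s(\cdot;\gamma)$ on the sites with $C(\pi,\gamma)=\dfrac{\pi_z u(z;\gamma)+\pi_{z'}u(z';\gamma)}{\pi_z s(z;\gamma)+\pi_{z'}s(z';\gamma)}$, the denominator being strictly positive for all $\pi\in\Delta_{1}$, $\gamma\in(0,1)$. Moreover for $w\in\{z,z'\}$, $u(w;\gamma)=\sum_{\nu=1}^N f_\nu(\gamma)A_\nu(w)$ and $s(w;\gamma)=\sum_{\nu=1}^N f_\nu(\gamma)(A_\nu(w)+B_\nu(w))$ with $N\ge 1$ and real coefficients $A_\nu(w),B_\nu(w)$, where $f_1,\dots,f_N$ are linearly independent functions on $(0,1)$ and the two vectors $(A_\nu(z))_{\nu=1}^N$, $(A_\nu(z'))_{\nu=1}^N$ are linearly independent in $\mathbb{R}^N$. (S3) $\sigma$ is the involution of $\{z,z'\}$ exchanging $z$ and $z'$, and there are weights $\kappa(z),\kappa(z')>0$, independent of $\nu$, such that $B_\nu(w)=\kappa(w)A_\nu(\sigma(w))$ for all $\nu$ and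 $w\in\{z,z'\}$. (S4) There is a constant $K>0$ with $\kappa(w)\kappa(\sigma(w))=K$ for $w\in\{z,z'\}$. "Unique global separatrix" means exactly that (i) and (ii) hold, so that $\alpha^*$ is the only $\alpha\in(0,1)$ for which $\gamma\mapsto C(\alpha,\gamma)$ is constant. Assumption (M) includes that $R$ is well defined (i.e. $u(z';\gamma)\ne0$) and differentiable on $(0,1)$. *)

theory Defs
  imports "HOL-Analysis.Analysis"
begin

(* Weights are required to vanish off S, so that distinct elements are distinct
   distributions on S. *)
definition prob_simplex :: "'a set \<Rightarrow> ('a \<Rightarrow> real) set" where
  "prob_simplex S = {p. (\<forall>w\<in>S. 0 \<le> p w) \<and> (\<forall>w. w \<notin> S \<longrightarrow> p w = 0) \<and> (\<Sum>w\<in>S. p w) = 1}"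

definition two_point :: "'a \<Rightarrow> 'a \<Rightarrow> real \<Rightarrow> 'a \<Rightarrow> real" where
  "two_point z z' \<alpha> = (\<lambda>w. if w = z then \<alpha> else if w = z' then 1 - \<alpha> else 0)"

lemma prob_simplex_two_point:
  assumes "z \<noteq> z'"
  shows "prob_simplex {z, z'} = two_point z z' ` {0..1}"
    and "{p \<in> prob_simplex {z, z'}. \<forall>w\<in>{z, z'}. 0 < p w} = two_point z z' ` {0<..<1}"
proof -
  have rep: "p = two_point z z' (p z)" if "p \<in> prob_simplex {z, z'}" for p
    using that assms by (auto simp: prob_simplex_def two_point_def fun_eq_iff)
  have rng: "p z \<in> {0..1}" if "p \<in> prob_simplex {z, z'}" for p
    using that assms by (auto simp: prob_simplex_def)
  have mem: "two_point z z' a \<in> prob_simplex {z, z'}" if "a \<in> {0..1}" for a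
    using that assms by (auto simp: prob_simplex_def two_point_def)
  show "prob_simplex {z, z'} = two_point z z' ` {0..1}"
    using rep rng mem by blast
  show "{p \<in> prob_simplex {z, z'}. \<forall>w\<in>{z, z'}. 0 < p w} = two_point z z' ` {0<..<1}"
  proof (intro set_eqI iffI)
    fix p assume "p \<in> {p \<in> prob_simplex {z, z'}. \<forall>w\<in>{z, z'}. 0 < p w}"
    then have p: "p \<in> prob_simplex {z, z'}" "0 < p z" "0 < p z'" by auto
    then have "p z \<in> {0<..<1}" using assms by (auto simp: prob_simplex_def)
    then show "p \<in> two_point z z' ` {0<..<1}" using rep[OF p(1)] by blast
  next
    fix p assume "p \<in> two_point z z' ` {0<..<1}"
    then obtain a where a: "a \<in> {0<..<1}" "p = two_point z z' a" by blast
    then show "p \<in> {p \<in> prob_simplex {z, z'}. \<forall>w\<in>{z, z'}. 0 < p w}"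
      using mem[of a] assms by (auto simp: two_point_def)
  qed
qed

(* Linear independence, over the reals, of the indexed family of functions g i
   restricted to X.  Since the family is indexed, repeated members are dependent. *)
definition lin_indep_on :: "'i set \<Rightarrow> ('i \<Rightarrow> 'x \<Rightarrow> real) \<Rightarrow> 'x set \<Rightarrow> bool" where
  "lin_indep_on I g X \<longleftrightarrow>
     (\<forall>c. (\<forall>x\<in>X. (\<Sum>i\<in>I. c i * g i x) = 0) \<longrightarrow> (\<forall>i\<in>I. c i = 0))"

(* Only meaningful for open S: the derivatives are unrestricted. *)
primrec Ck_on :: "nat \<Rightarrow> 'a::euclidean_space set \<Rightarrow> ('a \<Rightarrow> real) \<Rightarrow> bool" where
  "Ck_on 0 S f \<longleftrightarrow> continuous_on S f"
| "Ck_on (Suc k) S f \<longleftrightarrow>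
     (\<forall>x\<in>S. f differentiable (at x)) \<and>
     (\<forall>b\<in>Basis. Ck_on k S (\<lambda>x. frechet_derivative f (at x) b))"

definition smooth_on :: "'a::euclidean_space set \<Rightarrow> ('a \<Rightarrow> real) \<Rightarrow> bool" where
  "smooth_on S f \<longleftrightarrow> (\<forall>k. Ck_on k S f)"

definition strictly_monotone_on :: "real set \<Rightarrow> (real \<Rightarrow> real) \<Rightarrow> bool" where
  "strictly_monotone_on S f \<longleftrightarrow> strict_mono_on S f \<or> strict_antimono_on S f"

end

(* By the exchange symmetry, dividing through by u(z') turns C(alpha, -) into a Moebius function
   of R whose determinant is alpha^2 kappa(z) - (1 - alpha)^2 kappa(z').  The determinant vanishes
   exactly at alpha^*, where C is constant; elsewhere its sign, that of alpha - alpha^*, multiplies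
   the sign of R' in the derivative. *)

theory Submission
  imports Defs
begin

text \<open>In the numerator of the quotient rule the terms containing \<open>R x\<close> cancel,
  leaving the determinant \<open>m * q - n * p\<close> times \<open>d\<close>. The sign of the
  derivative therefore depends on \<open>R\<close> only through \<open>d\<close>.\<close>

lemma has_real_derivative_moebius:
  fixes R :: "real \<Rightarrow> real"
  assumes "(R has_real_derivative d) (at x within S)" and "p * R x + q \<noteq> 0"
  shows "((\<lambda>x. (m * R x + n) / (p * R x + q)) has_real_derivative
           (m * q - n * p) * d / (p * R x + q)\<^sup>2) (at x within S)"
proof -
  have "((\<lambda>x. (m * R x + n) / (p * R x + q)) has_real_derivative
      (m * d * (p * R x + q) - (m * R x + n) * (p * d)) / ((p * R x + q) * (p * R x + q)))
      (at x within S)"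
    \<comment> \<open>\<open>E = 0\<close> is the derivative of the additive constants
      \<open>n\<close> and \<open>q\<close>; simplifying drops this zero summand.\<close>
    using assms by (auto intro!: DERIV_divide DERIV_add[where E = 0, simplified] DERIV_cmult)
  moreover have "m * d * (p * R x + q) - (m * R x + n) * (p * d) = (m * q - n * p) * d"
    by (simp add: algebra_simps)
  ultimately show ?thesis by (simp add: power2_eq_square)
qed

text \<open>Mean value theorem on each pair \<open>x < y\<close>. Since \<open>c\<close> is one
  nonzero sign for the whole interval, the direction is the same for every pair.\<close>

lemma strictly_monotone_on_deriv_sgn:
  fixes g :: "real \<Rightarrow> real"
  assumes "\<And>x. x \<in> {a<..<b} \<Longrightarrow> g differentiable (at x)"
    and "\<And>x. x \<in> {a<..<b} \<Longrightarrow> sgn (deriv g x) = c" and "c \<noteq> 0"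
  shows "strictly_monotone_on {a<..<b} g"
proof -
  have der: "(g has_real_derivative deriv g x) (at x)" if "x \<in> {a<..<b}" for x
    using assms(1)[OF that] by (simp add: DERIV_deriv_iff_real_differentiable)
  have step: "g x < g y \<and> 0 < c \<or> g y < g x \<and> c < 0"
    if xy: "x \<in> {a<..<b}" "y \<in> {a<..<b}" "x < y" for x y
  proof (cases "0 < c")
    case True
    have "g x < g y"
    proof (rule DERIV_pos_imp_increasing[OF \<open>x < y\<close>])
      fix t assume "x \<le> t" "t \<le> y"
      then have t: "t \<in> {a<..<b}" using xy by auto
      have "0 < deriv g t" using assms(2)[OF t] True by (metis sgn_greater)
      then show "\<exists>d. (g has_real_derivative d) (at t) \<and> 0 < d" using der[OF t] by blast
    qed
    then show ?thesis using True by simp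
  next
    case False
    then have "c < 0" using \<open>c \<noteq> 0\<close> by simp
    have "g y < g x"
    proof (rule DERIV_neg_imp_decreasing[OF \<open>x < y\<close>])
      fix t assume "x \<le> t" "t \<le> y"
      then have t: "t \<in> {a<..<b}" using xy by auto
      have "deriv g t < 0" using assms(2)[OF t] \<open>c < 0\<close> by (metis sgn_less)
      then show "\<exists>d. (g has_real_derivative d) (at t) \<and> d < 0" using der[OF t] by blast
    qed
    then show ?thesis using \<open>c < 0\<close> by simp
  qed
  show ?thesis
  proof (cases "0 < c")
    case True
    then have "strict_mono_on {a<..<b} g" using step by (intro strict_mono_onI) force
    then show ?thesis by (simp add: strictly_monotone_on_def)
  next
    case False
    then have "strict_antimono_on {a<..<b} g" using step by (intro monotone_onI) force
    then show ?thesis by (simp add: strictly_monotone_on_def)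
  qed
qed

lemma strictly_monotone_on_not_constant:
  assumes "strictly_monotone_on {a<..<b} g" and "a < b"
  shows "\<not> g constant_on {a<..<b}"
proof
  assume "g constant_on {a<..<b}"
  moreover obtain x where x: "a < x" "x < b" using dense[OF \<open>a < b\<close>] by blast
  moreover obtain y where y: "x < y" "y < b" using dense[OF x(2)] by blast
  ultimately have "g x = g y" "x \<in> {a<..<b}" "y \<in> {a<..<b}" by (auto simp: constant_on_def)
  then show False
    using assms(1) y(1) unfolding strictly_monotone_on_def monotone_on_def
    by (metis less_irrefl)
qed

text \<open>The left-hand argument is a difference of two squares. Its sum factor is positive on
  (0,1); its difference factor is affine in \<alpha> with slope \<open>sqrt a + sqrt b\<close> > 0
  and its zero at the separatrix.\<close>

lemma sgn_separatrix_determinant: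
  fixes a b \<alpha> :: real
  assumes "0 < a" "0 < b" "0 < \<alpha>" "\<alpha> < 1"
  shows "sgn (\<alpha>\<^sup>2 * a - (1 - \<alpha>)\<^sup>2 * b) = sgn (\<alpha> - sqrt b / (sqrt a + sqrt b))"
proof -
  let ?r = "sqrt a" and ?t = "sqrt b"
  have pos: "0 < ?r" "0 < ?t" using assms by simp_all
  have "\<alpha>\<^sup>2 * ?r\<^sup>2 - (1 - \<alpha>)\<^sup>2 * ?t\<^sup>2 = (\<alpha> * ?r + (1 - \<alpha>) * ?t) * (\<alpha> * ?r - (1 - \<alpha>) * ?t)"
    by (simp add: power2_eq_square algebra_simps)
  also have "\<alpha> * ?r - (1 - \<alpha>) * ?t = (?r + ?t) * (\<alpha> - ?t / (?r + ?t))"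
  proof -
    have "(?r + ?t) * (?t / (?r + ?t)) = ?t" using add_pos_pos[OF pos] by simp
    then show ?thesis by (simp only: right_diff_distrib) (simp add: algebra_simps)
  qed
  finally have "\<alpha>\<^sup>2 * a - (1 - \<alpha>)\<^sup>2 * b
      = ((\<alpha> * ?r + (1 - \<alpha>) * ?t) * (?r + ?t)) * (\<alpha> - ?t / (?r + ?t))"
    using assms by simp
  moreover have "sgn ((\<alpha> * ?r + (1 - \<alpha>) * ?t) * (?r + ?t)) = 1"
    unfolding sgn_1_pos using pos assms by (simp add: add_pos_pos)
  ultimately show ?thesis by (simp only: sgn_mult mult_1_left)
qed

theorem theorem6p2:
  fixes z z' :: 'a
    and \<sigma> :: "'a \<Rightarrow> 'a"
    and C :: "('a \<Rightarrow> real) \<Rightarrow> real \<Rightarrow> real"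
    and u s :: "'a \<Rightarrow> real \<Rightarrow> real"
    and N :: nat
    and f :: "nat \<Rightarrow> real \<Rightarrow> real"
    and A B :: "nat \<Rightarrow> 'a \<Rightarrow> real"
    and \<kappa> :: "'a \<Rightarrow> real"
    and K :: real
    and R :: "real \<Rightarrow> real"
    and \<alpha>s Cs :: real
  assumes sites: "z \<noteq> z'"
    and C_smooth: "smooth_on ({0<..<1} \<times> {0<..<1}) (\<lambda>(\<alpha>, \<gamma>). C (two_point z z' \<alpha>) \<gamma>)"
    and S1_C1: "\<And>\<gamma>. \<gamma> \<in> {0<..<1} \<Longrightarrow>
        (\<lambda>\<alpha>. C (two_point z z' \<alpha>) \<gamma>) C1_differentiable_on {0<..<1}"
    and S1_boundary: "\<And>\<gamma>. \<gamma> \<in> {0<..<1} \<Longrightarrow>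
        continuous_on (prob_simplex {z, z'}) (\<lambda>p. C p \<gamma>)"
    and S2_C: "\<And>p \<gamma>. p \<in> prob_simplex {z, z'} \<Longrightarrow> \<gamma> \<in> {0<..<1} \<Longrightarrow>
        C p \<gamma> = (p z * u z \<gamma> + p z' * u z' \<gamma>) / (p z * s z \<gamma> + p z' * s z' \<gamma>)"
    and S2_pos: "\<And>p \<gamma>. p \<in> prob_simplex {z, z'} \<Longrightarrow> \<gamma> \<in> {0<..<1} \<Longrightarrow>
        0 < p z * s z \<gamma> + p z' * s z' \<gamma>"
    and S2_N: "1 \<le> N"
    and S2_u: "\<And>w \<gamma>. w \<in> {z, z'} \<Longrightarrow> \<gamma> \<in> {0<..<1} \<Longrightarrow>
        u w \<gamma> = (\<Sum>\<nu>=1..N. f \<nu> \<gamma> * A \<nu> w)"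
    and S2_s: "\<And>w \<gamma>. w \<in> {z, z'} \<Longrightarrow> \<gamma> \<in> {0<..<1} \<Longrightarrow>
        s w \<gamma> = (\<Sum>\<nu>=1..N. f \<nu> \<gamma> * (A \<nu> w + B \<nu> w))"
    and S2_f: "lin_indep_on {1..N} f {0<..<1}"
    and S2_A: "lin_indep_on {z, z'} (\<lambda>w \<nu>. A \<nu> w) {1..N}"
    and S3_sigma: "\<sigma> z = z'" "\<sigma> z' = z"
    and S3_kappa: "\<And>w. w \<in> {z, z'} \<Longrightarrow> 0 < \<kappa> w"
    and S3_B: "\<And>\<nu> w. \<nu> \<in> {1..N} \<Longrightarrow> w \<in> {z, z'} \<Longrightarrow> B \<nu> w = \<kappa> w * A \<nu> (\<sigma> w)"
    and S4_pos: "0 < K"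
    and S4: "\<And>w. w \<in> {z, z'} \<Longrightarrow> \<kappa> w * \<kappa> (\<sigma> w) = K"
    and M_nonzero: "\<And>\<gamma>. \<gamma> \<in> {0<..<1} \<Longrightarrow> u z' \<gamma> \<noteq> 0"
    and R_eq: "\<And>\<gamma>. \<gamma> \<in> {0<..<1} \<Longrightarrow> R \<gamma> = u z \<gamma> / u z' \<gamma>"
    and M_diff: "\<And>\<gamma>. \<gamma> \<in> {0<..<1} \<Longrightarrow> R differentiable (at \<gamma>)"
    and M_mono: "strictly_monotone_on {0<..<1} R"
    and M_nz: "\<And>\<gamma>. \<gamma> \<in> {0<..<1} \<Longrightarrow> deriv R \<gamma> \<noteq> 0"
    and M_sgn: "(\<lambda>\<gamma>. sgn (deriv R \<gamma>)) constant_on {0<..<1}"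
    and alpha_star: "\<alpha>s = sqrt (\<kappa> z') / (sqrt (\<kappa> z) + sqrt (\<kappa> z'))"
    and C_star: "Cs = 1 / (1 + sqrt K)"
  shows "\<alpha>s \<in> {0<..<1}
    \<and> (\<forall>\<gamma>\<in>{0<..<1}. C (two_point z z' \<alpha>s) \<gamma> = Cs)
    \<and> (\<forall>\<alpha>\<in>{0<..<1}. \<alpha> \<noteq> \<alpha>s \<longrightarrow>
          strictly_monotone_on {0<..<1} (C (two_point z z' \<alpha>))
        \<and> (\<forall>\<gamma>\<in>{0<..<1}. C (two_point z z' \<alpha>) differentiable (at \<gamma>))
        \<and> (\<lambda>\<gamma>. sgn (deriv (C (two_point z z' \<alpha>)) \<gamma>)) constant_on {0<..<1}
        \<and> (\<forall>\<gamma>\<in>{0<..<1}. sgn (deriv (C (two_point z z' \<alpha>)) \<gamma>) = sgn (\<alpha> - \<alpha>s) * sgn (deriv R \<gamma>)))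
    \<and> (\<forall>\<alpha>\<in>{0<..<1}. C (two_point z z' \<alpha>) constant_on {0<..<1} \<longleftrightarrow> \<alpha> = \<alpha>s)"
proof -
  define a b where "a = \<kappa> z" and "b = \<kappa> z'"
  have ab: "0 < a" "0 < b" using S3_kappa by (auto simp: a_def b_def)
  have K: "K = a * b" using S4[of z] S3_sigma by (simp add: a_def b_def)
  have as: "\<alpha>s = sqrt b / (sqrt a + sqrt b)" by (simp add: alpha_star a_def b_def)
  have as01: "\<alpha>s \<in> {0<..<1}" using ab by (simp add: as add_pos_pos)
  \<comment> \<open>The exchange relation between the coefficients \<open>B\<close> and
    \<open>A\<close> passes to the sums because the weight \<kappa> does not depend on
    \<nu>.\<close>
  have s_eq: "s w \<gamma> = u w \<gamma> + \<kappa> w * u (\<sigma> w) \<gamma>" if "w \<in> {z, z'}" "\<gamma> \<in> {0<..<1}" for w \<gamma>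
  proof -
    have "\<sigma> w \<in> {z, z'}" using that S3_sigma by auto
    then have "u w \<gamma> + \<kappa> w * u (\<sigma> w) \<gamma> = (\<Sum>\<nu>=1..N. f \<nu> \<gamma> * (A \<nu> w + \<kappa> w * A \<nu> (\<sigma> w)))"
      using that by (simp add: S2_u sum_distrib_left sum.distrib[symmetric] algebra_simps)
    also have "\<dots> = s w \<gamma>" using that by (simp add: S2_s S3_B)
    finally show ?thesis by simp
  qed
  \<comment> \<open>\<open>P\<close> and \<open>Q\<close> collect the coefficients of
    \<open>u z\<close> and \<open>u z'\<close> in the denominator of C: the exchange sends the term
    weighted by \<open>b\<close> to \<open>u z\<close> and the one weighted by \<open>a\<close> to
    \<open>u z'\<close>.\<close>
  define P where "P \<alpha> = \<alpha> + (1 - \<alpha>) * b" for \<alpha>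
  define Q where "Q \<alpha> = \<alpha> * a + (1 - \<alpha>)" for \<alpha>
  have moebius: "P \<alpha> * R \<gamma> + Q \<alpha> \<noteq> 0"
      "C (two_point z z' \<alpha>) \<gamma> = (\<alpha> * R \<gamma> + (1 - \<alpha>)) / (P \<alpha> * R \<gamma> + Q \<alpha>)"
    if \<alpha>: "\<alpha> \<in> {0<..<1}" and \<gamma>: "\<gamma> \<in> {0<..<1}" for \<alpha> \<gamma>
  proof -
    let ?p = "two_point z z' \<alpha>" and ?v = "u z' \<gamma>"
    have p: "?p \<in> prob_simplex {z, z'}" "?p z = \<alpha>" "?p z' = 1 - \<alpha>"
      using \<alpha> sites by (auto simp: prob_simplex_def two_point_def)
    have v: "?v \<noteq> 0" using M_nonzero[OF \<gamma>] .
    have u: "u z \<gamma> = R \<gamma> * ?v" using v by (simp add: R_eq[OF \<gamma>])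
    have num: "\<alpha> * u z \<gamma> + (1 - \<alpha>) * ?v = (\<alpha> * R \<gamma> + (1 - \<alpha>)) * ?v"
      by (simp add: u algebra_simps)
    have den: "\<alpha> * s z \<gamma> + (1 - \<alpha>) * s z' \<gamma> = (P \<alpha> * R \<gamma> + Q \<alpha>) * ?v"
      using \<gamma> S3_sigma by (simp add: s_eq u P_def Q_def a_def b_def algebra_simps)
    \<comment> \<open>Positivity of the original denominator, which is this factor times
      \<open>u z'\<close>, yields only that the factor is nonzero: its sign is that of
      \<open>u z'\<close>, which may be negative.\<close>
    show "P \<alpha> * R \<gamma> + Q \<alpha> \<noteq> 0" using S2_pos[OF p(1) \<gamma>] by (auto simp: p den)
    show "C ?p \<gamma> = (\<alpha> * R \<gamma> + (1 - \<alpha>)) / (P \<alpha> * R \<gamma> + Q \<alpha>)"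
      using v by (simp add: S2_C[OF p(1) \<gamma>] p(2,3) num den)
  qed
  \<comment> \<open>The mixed terms \<alpha>(1 - \<alpha>) cancel, so only the two squares
    remain.\<close>
  have det: "\<alpha> * Q \<alpha> - (1 - \<alpha>) * P \<alpha> = \<alpha>\<^sup>2 * a - (1 - \<alpha>)\<^sup>2 * b" for \<alpha>
    by (simp add: P_def Q_def power2_eq_square algebra_simps)

  have const: "C (two_point z z' \<alpha>s) \<gamma> = Cs" if \<gamma>: "\<gamma> \<in> {0<..<1}" for \<gamma>
  proof -
    define r t where "r = sqrt a" and "t = sqrt b"
    have "0 < r" "0 < t" using ab by (simp_all add: r_def t_def)
    then have rt: "r + t \<noteq> 0" by simp
    have a: "a = r * r" and b: "b = t * t" using ab by (simp_all add: r_def t_def)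
    have sK: "sqrt K = r * t" by (simp add: K real_sqrt_mult r_def t_def)
    have as': "\<alpha>s = t / (r + t)" by (simp add: as r_def t_def)
    then have 1: "1 - \<alpha>s = r / (r + t)" using rt by (simp add: field_simps)
    \<comment> \<open>At the separatrix the coefficient pairs of denominator and numerator are
      proportional: with \<open>b = t * t\<close>, the term (1 - \<alpha>s) b equals r t^2 / (r +
      t), that is \<alpha>s r t; symmetrically for \<open>Q\<close>.\<close>
    have "P \<alpha>s = \<alpha>s * (1 + sqrt K)" "Q \<alpha>s = (1 - \<alpha>s) * (1 + sqrt K)"
      unfolding P_def Q_def 1 unfolding sK as' a b by (simp_all add: algebra_simps add_divide_distrib)
    then have eq: "P \<alpha>s * R \<gamma> + Q \<alpha>s = (\<alpha>s * R \<gamma> + (1 - \<alpha>s)) * (1 + sqrt K)"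
      by (simp add: algebra_simps)
    \<comment> \<open>The common factor may be cancelled: the denominator is nonzero, hence so is
      the numerator dividing it.\<close>
    with moebius[OF as01 \<gamma>] show ?thesis by (simp add: C_star)
  qed

  have der: "(C (two_point z z' \<alpha>) has_real_derivative
      (\<alpha>\<^sup>2 * a - (1 - \<alpha>)\<^sup>2 * b) * deriv R \<gamma> / (P \<alpha> * R \<gamma> + Q \<alpha>)\<^sup>2) (at \<gamma>)"
    if \<alpha>: "\<alpha> \<in> {0<..<1}" and \<gamma>: "\<gamma> \<in> {0<..<1}" for \<alpha> \<gamma>
  proof -
    have "(R has_real_derivative deriv R \<gamma>) (at \<gamma>)"
      using M_diff[OF \<gamma>] by (simp add: DERIV_deriv_iff_real_differentiable)
    note has_real_derivative_moebius[OF this moebius(1)[OF \<alpha> \<gamma>], of \<alpha> "1 - \<alpha>", unfolded det]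
    then show ?thesis
      \<comment> \<open>The Moebius formula for C is known only on (0,1); openness of the interval
        makes this enough for the derivative at \<gamma>.\<close>
      by (rule has_field_derivative_transform_within_open[of _ _ _ "{0<..<1}"])
        (use \<gamma> moebius(2)[OF \<alpha>] in auto)
  qed
  have diff: "C (two_point z z' \<alpha>) differentiable (at \<gamma>)"
    if "\<alpha> \<in> {0<..<1}" "\<gamma> \<in> {0<..<1}" for \<alpha> \<gamma>
    using der[OF that] real_differentiable_def by blast
  have sgn_C: "sgn (deriv (C (two_point z z' \<alpha>)) \<gamma>) = sgn (\<alpha> - \<alpha>s) * sgn (deriv R \<gamma>)"
    if \<alpha>: "\<alpha> \<in> {0<..<1}" and \<gamma>: "\<gamma> \<in> {0<..<1}" for \<alpha> \<gamma>
  proof -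
    \<comment> \<open>Squaring removes the undetermined sign of the denominator, so the determinant
      and R' alone decide the sign of the derivative.\<close>
    have "sgn ((P \<alpha> * R \<gamma> + Q \<alpha>)\<^sup>2) = 1" unfolding sgn_1_pos using moebius(1)[OF \<alpha> \<gamma>] by simp
    then show ?thesis
      using sgn_separatrix_determinant[OF ab, of \<alpha>] \<alpha>
      by (simp add: DERIV_imp_deriv[OF der[OF \<alpha> \<gamma>]] as sgn_mult sgn_divide)
  qed

  obtain c where c: "\<And>\<gamma>. \<gamma> \<in> {0<..<1} \<Longrightarrow> sgn (deriv R \<gamma>) = c"
    using M_sgn by (auto simp: constant_on_def)
  \<comment> \<open>1/2 serves as a sample point of (0,1).\<close>
  have c0: "c \<noteq> 0" using c[of "1/2"] M_nz[of "1/2"] by (auto simp: sgn_zero_iff)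
  have mono: "strictly_monotone_on {0<..<1} (C (two_point z z' \<alpha>))"
    if \<alpha>: "\<alpha> \<in> {0<..<1}" "\<alpha> \<noteq> \<alpha>s" for \<alpha>
    by (rule strictly_monotone_on_deriv_sgn[where c = "sgn (\<alpha> - \<alpha>s) * c"])
      (use \<alpha> diff sgn_C c c0 in \<open>auto simp: sgn_zero_iff\<close>)
  have sgn_const: "(\<lambda>\<gamma>. sgn (deriv (C (two_point z z' \<alpha>)) \<gamma>)) constant_on {0<..<1}"
    if "\<alpha> \<in> {0<..<1}" for \<alpha>
    unfolding constant_on_def using sgn_C[OF that] c by auto
  \<comment> \<open>Uniqueness: away from \<alpha>s strict monotonicity excludes constancy, and at
    \<alpha>s the constant value is \<open>Cs\<close>.\<close>
  have iff: "C (two_point z z' \<alpha>) constant_on {0<..<1} \<longleftrightarrow> \<alpha> = \<alpha>s" if "\<alpha> \<in> {0<..<1}" for \<alpha>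
    using strictly_monotone_on_not_constant[OF mono[OF that]] const
    by (auto simp: constant_on_def)
  show ?thesis
    by (intro conjI ballI impI) (simp_all only: as01 const mono diff sgn_const sgn_C iff not_False_eq_True)
qed

end
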